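(* Let $G$ be an abelian group and $\bullet$ be a bilinear product on the group algebra $\mathbb{K}G$. Then $(\mathbb{K}G,m,\bullet,\Delta)$ is a Com-PreLie bialgebra if, and only if, there exists a family $(\lambda(g,h))_{g,h\in G}$ of scalars such that \begin{align*} &\forall g\in G, & \lambda(g,1)&=0,\\ &\forall g,h,k\in G, & \lambda(gh,k)&=\lambda(g,k)+\lambda(h,k),\\ &\forall g,h,k\in G\text{ with }hk\neq1, & \lambda(g,hk)\lambda(h,k)-\lambda(g,h)\lambda(h,k)&=\lambda(g,hk)\lambda(k,h)-\lambda(g,k)\lambda(k,h),\\ &\forall g,h\in G, & g\bullet h&=\lambda(g,h)(g-gh). \end{align*}
   Context: $\mathbb{K}$ is a field of characteristic zero. $\mathbb{K}G$ is the group Hopf algebra, with product $m$ extending that of $G$ bilinearly and $\Delta(g)=g\otimes g$ for $g\in G$; $1$ is the unit of $G$. A Com-PreLie algebra is a vector space $A$ with bilinear products $\cdot,\bullet$ such that $\cdot$ is commutative and associative and, for all $a,b,c\in A$, $(a\bullet b)\bullet c-a\bullet(b\bullet c)=(a\bullet c)\bullet b-a\bullet(c\bullet b)$ and $(a\cdot b)\bullet c=(a\bullet c)\cdot b+a\cdot(b\bullet c)$. A Com-PreLie bialgebra is $(A,\cdot,\bullet,\Delta)$ such that $(A,\cdot,\bullet)$ is a Com-PreLie algebra with a unit for $\cdot$, $(A,\cdot,\Delta)$ is a bialgebra, and $\Delta(a\bullet b)=a^{(1)}\otimes a^{(2)}\bullet b+a^{(1)}\bullet b^{(1)}\otimes a^{(2)}\cdot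 b^{(2)}$ for all $a,b\in A$ (Sweedler's notation). *)

theory Defs
  imports Complex_Main "HOL-Library.Poly_Mapping"
begin

section \<open>Free vector spaces\<close>

text \<open>The space \<open>'x \<Rightarrow>\<^sub>0 'k\<close> is the free vector space on \<open>'x\<close>; the basis vector at \<open>x\<close> is
  \<open>Poly_Mapping.single x 1\<close>. The library provides its additive structure only.\<close>

definition fscale :: "'k::field \<Rightarrow> ('x \<Rightarrow>\<^sub>0 'k) \<Rightarrow> ('x \<Rightarrow>\<^sub>0 'k)" where
  "fscale c p = Poly_Mapping.map ((*) c) p"

lemma lookup_fscale [simp]: "Poly_Mapping.lookup (fscale c p) x = c * Poly_Mapping.lookup p x"
  by (simp add: fscale_def Poly_Mapping.map.rep_eq when_def)

lemma vector_space_fscale: "vector_space fscale"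
  by unfold_locales (rule poly_mapping_eqI; simp add: lookup_add algebra_simps)+

definition lin_ext ::
    "('k::field \<Rightarrow> 'b \<Rightarrow> 'b) \<Rightarrow> ('x \<Rightarrow> 'b) \<Rightarrow> ('x \<Rightarrow>\<^sub>0 'k) \<Rightarrow> 'b::ab_group_add" where
  "lin_ext s f p = (\<Sum>x\<in>Poly_Mapping.keys p. s (Poly_Mapping.lookup p x) (f x))"

definition bilinear_op :: "('k::field \<Rightarrow> 'a \<Rightarrow> 'a) \<Rightarrow> ('a \<Rightarrow> 'a \<Rightarrow> 'a::ab_group_add) \<Rightarrow> bool" where
  "bilinear_op s m \<longleftrightarrow>
     (\<forall>x. Vector_Spaces.linear s s (m x)) \<and> (\<forall>y. Vector_Spaces.linear s s (\<lambda>x. m x y))"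


section \<open>Tensor powers\<close>

text \<open>The tensor powers of a vector space \<open>A\<close> are the quotients of the free vector spaces on
  \<open>A \<times> A\<close> and \<open>A \<times> A \<times> A\<close> by the subspaces spanned by the multilinearity relations. Their elements are
  handled through representatives (formal linear combinations of pure tensors), and equality in
  the tensor power is the congruence \<open>tensor2_eq\<close>, respectively \<open>tensor3_eq\<close>.

  In \<open>slot_rels s t\<close> the function \<open>t\<close> is a pure tensor as a function of one of its slots.\<close>

definition slot_rels ::
    "('k::field \<Rightarrow> 'a::ab_group_add \<Rightarrow> 'a) \<Rightarrow> ('a \<Rightarrow> 'x) \<Rightarrow> ('x \<Rightarrow>\<^sub>0 'k) set" where
  "slot_rels s t =
     {Poly_Mapping.single (t (x + y)) 1 - Poly_Mapping.single (t x) 1 - Poly_Mapping.single (t y) 1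
        | x y. True} \<union>
     {Poly_Mapping.single (t (s c x)) 1 - fscale c (Poly_Mapping.single (t x) 1) | c x. True}"

definition tensor2_eq ::
    "('k::field \<Rightarrow> 'a::ab_group_add \<Rightarrow> 'a) \<Rightarrow> ('a \<times> 'a \<Rightarrow>\<^sub>0 'k) \<Rightarrow> ('a \<times> 'a \<Rightarrow>\<^sub>0 'k) \<Rightarrow> bool" where
  "tensor2_eq s p q \<longleftrightarrow> p - q \<in> module.span fscale
     (\<Union>y. slot_rels s (\<lambda>x. (x, y)) \<union> slot_rels s (\<lambda>x. (y, x)))"

definition tensor3_eq ::
    "('k::field \<Rightarrow> 'a::ab_group_add \<Rightarrow> 'a) \<Rightarrow>
     ('a \<times> 'a \<times> 'a \<Rightarrow>\<^sub>0 'k) \<Rightarrow> ('a \<times> 'a \<times> 'a \<Rightarrow>\<^sub>0 'k) \<Rightarrow> bool" where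
  "tensor3_eq s p q \<longleftrightarrow> p - q \<in> module.span fscale
     (\<Union>y z. slot_rels s (\<lambda>x. (x, y, z)) \<union> slot_rels s (\<lambda>x. (y, x, z)) \<union> slot_rels s (\<lambda>x. (y, z, x)))"

text \<open>Sweedler sums: for \<open>p\<close> representing \<open>a\<^sup>1 \<otimes> a\<^sup>2\<close> (sum understood), \<open>sweedler s f p\<close> is the
  corresponding sum of the terms \<open>f a\<^sup>1 a\<^sup>2\<close>, in the vector space with scalar multiplication \<open>s\<close>.
  It respects \<open>tensor2_eq\<close> whenever \<open>f\<close> is bilinear.\<close>

definition sweedler ::
    "('k::field \<Rightarrow> 'b \<Rightarrow> 'b) \<Rightarrow> ('a \<Rightarrow> 'a \<Rightarrow> 'b) \<Rightarrow> ('a \<times> 'a \<Rightarrow>\<^sub>0 'k) \<Rightarrow> 'b::ab_group_add" where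
  "sweedler s f p = lin_ext s (\<lambda>(x, y). f x y) p"


section \<open>Bialgebras and Com-PreLie bialgebras\<close>

text \<open>A coproduct is given by a choice of representatives, hence it is linear only up to
  \<open>tensor2_eq\<close>.\<close>

locale bialgebra = vector_space scale
  for scale :: "'k::field \<Rightarrow> 'a::ab_group_add \<Rightarrow> 'a" +
  fixes mult :: "'a \<Rightarrow> 'a \<Rightarrow> 'a"
    and unit :: 'a
    and coprod :: "'a \<Rightarrow> ('a \<times> 'a \<Rightarrow>\<^sub>0 'k)"
    and counit :: "'a \<Rightarrow> 'k"
  assumes mult_bilinear: "bilinear_op scale mult"
    and mult_assoc: "mult (mult a b) c = mult a (mult b c)"
    and unit_left: "mult unit a = a"
    and unit_right: "mult a unit = a"
    and coprod_add: "tensor2_eq scale (coprod (a + b)) (coprod a + coprod b)"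
    and coprod_scale: "tensor2_eq scale (coprod (scale r a)) (fscale r (coprod a))"
    and counit_linear: "Vector_Spaces.linear scale (*) counit"
    and coassoc: "tensor3_eq scale
      (sweedler fscale (\<lambda>a1 a2. sweedler fscale
         (\<lambda>x y. Poly_Mapping.single (x, y, a2) 1) (coprod a1)) (coprod a))
      (sweedler fscale (\<lambda>a1 a2. sweedler fscale
         (\<lambda>x y. Poly_Mapping.single (a1, x, y) 1) (coprod a2)) (coprod a))"
    and counit_left: "sweedler scale (\<lambda>a1 a2. scale (counit a1) a2) (coprod a) = a"
    and counit_right: "sweedler scale (\<lambda>a1 a2. scale (counit a2) a1) (coprod a) = a"
    and coprod_mult: "tensor2_eq scale (coprod (mult a b))
      (sweedler fscale (\<lambda>a1 a2. sweedler fscale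
         (\<lambda>b1 b2. Poly_Mapping.single (mult a1 b1, mult a2 b2) 1) (coprod b)) (coprod a))"
    and coprod_unit: "tensor2_eq scale (coprod unit) (Poly_Mapping.single (unit, unit) 1)"
    and counit_mult: "counit (mult a b) = counit a * counit b"
    and counit_unit: "counit unit = 1"

locale com_prelie_algebra = vector_space scale
  for scale :: "'k::field \<Rightarrow> 'a::ab_group_add \<Rightarrow> 'a" +
  fixes mult :: "'a \<Rightarrow> 'a \<Rightarrow> 'a" (infixl \<open>\<cdot>\<close> 70)
    and prelie :: "'a \<Rightarrow> 'a \<Rightarrow> 'a" (infixl \<open>\<bullet>\<close> 70)
  assumes mult_bilinear: "bilinear_op scale (\<cdot>)"
    and prelie_bilinear: "bilinear_op scale (\<bullet>)"
    and mult_assoc: "(a \<cdot> b) \<cdot> c = a \<cdot> (b \<cdot> c)"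
    and mult_commute: "a \<cdot> b = b \<cdot> a"
    and prelie_identity: "(a \<bullet> b) \<bullet> c - a \<bullet> (b \<bullet> c) = (a \<bullet> c) \<bullet> b - a \<bullet> (c \<bullet> b)"
    and prelie_leibniz: "(a \<cdot> b) \<bullet> c = (a \<bullet> c) \<cdot> b + a \<cdot> (b \<bullet> c)"

locale com_prelie_bialgebra = com_prelie_algebra scale mult prelie
  for scale :: "'k::field \<Rightarrow> 'a::ab_group_add \<Rightarrow> 'a"
    and mult :: "'a \<Rightarrow> 'a \<Rightarrow> 'a" (infixl \<open>\<cdot>\<close> 70)
    and prelie :: "'a \<Rightarrow> 'a \<Rightarrow> 'a" (infixl \<open>\<bullet>\<close> 70) +
  fixes coprod :: "'a \<Rightarrow> ('a \<times> 'a \<Rightarrow>\<^sub>0 'k)"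
  assumes bialgebra: "\<exists>unit counit. bialgebra scale (\<cdot>) unit coprod counit"
    and coprod_prelie: "tensor2_eq scale (coprod (a \<bullet> b))
      (sweedler fscale (\<lambda>a1 a2. Poly_Mapping.single (a1, a2 \<bullet> b) 1) (coprod a) +
       sweedler fscale (\<lambda>a1 a2. sweedler fscale
         (\<lambda>b1 b2. Poly_Mapping.single (a1 \<bullet> b1, a2 \<cdot> b2) 1) (coprod b)) (coprod a))"


section \<open>The group Hopf algebra\<close>

text \<open>For an abelian group \<open>G\<close>, written additively as the type \<open>'g\<close>, the group algebra is
  \<open>'g \<Rightarrow>\<^sub>0 'k\<close> with scalar multiplication \<open>fscale\<close> and the library's convolution product \<open>(*)\<close>,
  which satisfies \<open>gelem g * gelem h = gelem (g + h)\<close>.\<close>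

definition gelem :: "'g \<Rightarrow> ('g \<Rightarrow>\<^sub>0 'k::field)" where
  "gelem g = Poly_Mapping.single g 1"

lemma gelem_mult:
  "gelem g * gelem h = (gelem (g + h) :: 'g::ab_group_add \<Rightarrow>\<^sub>0 'k::field)"
  by (simp add: gelem_def mult_single)

definition group_coprod ::
    "('g \<Rightarrow>\<^sub>0 'k::field) \<Rightarrow> (('g \<Rightarrow>\<^sub>0 'k) \<times> ('g \<Rightarrow>\<^sub>0 'k) \<Rightarrow>\<^sub>0 'k)" where
  "group_coprod = lin_ext fscale (\<lambda>g. Poly_Mapping.single (gelem g, gelem g) 1)"

end

theory Submission
  imports Defs
begin

text \<open>
  The whole statement can be checked on the basis of group elements, and there it comes down to
  three independent facts, told here with \<open>G\<close> written multiplicatively.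

  First, the compatibility of \<open>\<bullet>\<close> with the coproduct says, for group elements \<open>g\<close> and \<open>h\<close>, that
  \<open>x = g \<bullet> h\<close> satisfies \<open>\<Delta>(x) = g \<otimes> x + x \<otimes> gh\<close>, because group elements are grouplike. Such a
  skew-primitive element of a group algebra is a multiple of \<open>g - gh\<close>: the coefficients of \<open>\<Delta>(x)\<close>
  vanish off the diagonal, and comparing them on both sides leaves only \<open>x\<^sub>g\<close> and \<open>x\<^sub>g\<^sub>h = - x\<^sub>g\<close>
  (lemma \<open>skew_primitive_iff\<close>). The scalar is \<open>\<lambda>(g,h)\<close>, and it can be taken to be the coefficient
  of \<open>g\<close> in \<open>g \<bullet> h\<close>, which is zero for \<open>h = 1\<close>.

  Second, for a product of this form both sides of the Leibniz rule are multiples of \<open>gh - ghk\<close>,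
  with coefficients \<open>\<lambda>(gh,k)\<close> and \<open>\<lambda>(g,k) + \<lambda>(h,k)\<close> (lemma \<open>leibniz_basis_iff\<close>).

  Third, once \<open>\<lambda>\<close> is additive in its first argument, the associator of \<open>g, h, k\<close> is a term
  symmetric in \<open>h\<close> and \<open>k\<close> plus \<open>(\<lambda>(g,hk) \<lambda>(h,k) - \<lambda>(g,h) \<lambda>(h,k)) (g - ghk)\<close>. So the pre-Lie
  identity is the quadratic condition, except for \<open>hk = 1\<close>, where \<open>g - ghk = 0\<close>
  (lemma \<open>associator_symmetric_iff\<close>).

  Comparing coefficients in \<open>\<Delta>(x)\<close> requires that equality in the tensor square, a congruence on
  formal sums of pure tensors, be the equality of coordinates with respect to the tensors
  \<open>u \<otimes> v\<close> of basis vectors. This is lemma \<open>tensor2_eq_iff_coords\<close>. It turns the coproduct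
  identities into equations between honest linear maps, which can be verified on basis vectors.
\<close>

section \<open>Linear maps on free vector spaces\<close>

global_interpretation free: vector_space fscale
  by (rule vector_space_fscale)

lemma lookup_gelem: "Poly_Mapping.lookup (gelem x) y = (if x = y then 1 else 0)"
  by (simp add: gelem_def lookup_single when_def)

text \<open>This rule is the form in which "a linear identity holds as soon as it holds on the basis" is
  used below: an identity is reduced to basis vectors one argument at a time, and no predicate of
  linearity has to be established for the compound expressions on its two sides.\<close>

lemma free_vector_induct [case_names basis add scale]:
  assumes "\<And>x. P (gelem x)"
    and "\<And>p q. P p \<Longrightarrow> P q \<Longrightarrow> P (p + q)"
    and "\<And>c p. P p \<Longrightarrow> P (fscale c p)"
  shows "P p"
proof (induction p rule: update_induct)
  case const
  show ?case using assms(3) [OF assms(1), of 0] by simp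
next
  case (update p x c)
  have "Poly_Mapping.update x c p = p + fscale c (gelem x)"
    using update.hyps
    by (intro poly_mapping_eqI)
       (auto simp: lookup_update lookup_add lookup_gelem in_keys_iff)
  with update.IH show ?case by (simp add: assms)
qed

lemma lin_ext_eq_sum_superset:
  assumes "vector_space s" "finite S" "Poly_Mapping.keys p \<subseteq> S"
  shows "lin_ext s f p = (\<Sum>x\<in>S. s (Poly_Mapping.lookup p x) (f x))"
proof -
  interpret vector_space s by fact
  show ?thesis unfolding lin_ext_def
    by (rule sum.mono_neutral_left) (use assms in \<open>auto simp: in_keys_iff\<close>)
qed

lemma lin_ext_add:
  assumes "vector_space s"
  shows "lin_ext s f (p + q) = lin_ext s f p + lin_ext s f q"
proof -
  interpret vector_space s by fact
  let ?S = "Poly_Mapping.keys p \<union> Poly_Mapping.keys q"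
  have "lin_ext s f r = (\<Sum>x\<in>?S. s (Poly_Mapping.lookup r x) (f x))"
    if "Poly_Mapping.keys r \<subseteq> ?S" for r
    using assms that by (intro lin_ext_eq_sum_superset) auto
  then show ?thesis
    by (simp add: Poly_Mapping.keys_add lookup_add scale_left_distrib sum.distrib)
qed

lemma lin_ext_fscale:
  assumes "vector_space s"
  shows "lin_ext s f (fscale c p) = s c (lin_ext s f p)"
proof -
  interpret vector_space s by fact
  have "lin_ext s f (fscale c p)
      = (\<Sum>x\<in>Poly_Mapping.keys p. s (Poly_Mapping.lookup (fscale c p) x) (f x))"
    using assms by (intro lin_ext_eq_sum_superset) (auto simp: in_keys_iff)
  then show ?thesis by (simp add: lin_ext_def scale_sum_right)
qed

lemma lin_ext_gelem:
  assumes "vector_space s"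
  shows "lin_ext s f (gelem x) = f x"
proof -
  interpret vector_space s by fact
  show ?thesis by (simp add: lin_ext_def gelem_def)
qed

lemmas lin_ext_linear =
  lin_ext_add [OF vector_space_fscale] lin_ext_fscale [OF vector_space_fscale]
  lin_ext_gelem [OF vector_space_fscale]

lemma sweedler_linear:
  "sweedler fscale f (p + q) = sweedler fscale f p + sweedler fscale f q"
  "sweedler fscale f (fscale c p) = fscale c (sweedler fscale f p)"
  "sweedler fscale f (gelem (x, y)) = f x y"
  by (simp_all add: sweedler_def lin_ext_linear)

lemma sweedler_comp_linear:
  assumes "\<And>p q. T (p + q) = T p + T q" "\<And>c p. T (fscale c p) = fscale c (T p)"
  shows "T (sweedler fscale f p) = sweedler fscale (\<lambda>x y. T (f x y)) p"
proof (induction p rule: free_vector_induct)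
  case (basis x)
  show ?case by (cases x) (simp add: sweedler_linear)
qed (simp_all add: sweedler_linear assms)

lemma bilinear_op_iff:
  assumes "vector_space s"
  shows "bilinear_op s m \<longleftrightarrow>
    (\<forall>x y z. m x (y + z) = m x y + m x z) \<and> (\<forall>x c y. m x (s c y) = s c (m x y)) \<and>
    (\<forall>x y z. m (x + y) z = m x z + m y z) \<and> (\<forall>x c y. m (s c x) y = s c (m x y))"
  unfolding bilinear_op_def Vector_Spaces.linear_iff using assms by blast

lemma bilinear_op_fscaleD:
  assumes "bilinear_op fscale m"
  shows "m x (y + z) = m x y + m x z" "m x (fscale c y) = fscale c (m x y)"
    and "m (x + y) z = m x z + m y z" "m (fscale c x) y = fscale c (m x y)"
  using assms by (simp_all add: bilinear_op_iff [OF vector_space_fscale])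


section \<open>The tensor square of a free vector space\<close>

definition outer :: "('x \<Rightarrow>\<^sub>0 'k::field) \<Rightarrow> ('y \<Rightarrow>\<^sub>0 'k) \<Rightarrow> ('x \<times> 'y \<Rightarrow>\<^sub>0 'k)" where
  "outer a b = lin_ext fscale (\<lambda>u. lin_ext fscale (\<lambda>v. gelem (u, v)) b) a"

text \<open>If \<open>A\<close> is free on \<open>'x\<close>, then the tensor square of \<open>A\<close> is free on \<open>'x \<times> 'x\<close>; this map computes
  the class of a formal sum of pure tensors under that identification.\<close>

definition tensor_coords :: "(('x \<Rightarrow>\<^sub>0 'k::field) \<times> ('x \<Rightarrow>\<^sub>0 'k) \<Rightarrow>\<^sub>0 'k) \<Rightarrow> ('x \<times> 'x \<Rightarrow>\<^sub>0 'k)" where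
  "tensor_coords = sweedler fscale outer"

lemma outer_left:
  "outer (a + a') b = outer a b + outer a' b"
  "outer (fscale c a) b = fscale c (outer a b)"
  by (simp_all add: outer_def lin_ext_linear)

lemma outer_right:
  "outer a (b + b') = outer a b + outer a b'"
  "outer a (fscale c b) = fscale c (outer a b)"
proof -
  show "outer a (b + b') = outer a b + outer a b'"
    by (induction a rule: free_vector_induct)
       (simp_all add: outer_left free.scale_right_distrib, simp add: outer_def lin_ext_linear)
  show "outer a (fscale c b) = fscale c (outer a b)"
    by (induction a rule: free_vector_induct)
       (simp_all add: outer_left free.scale_right_distrib mult.commute,
         simp add: outer_def lin_ext_linear)
qed

lemma outer_gelem: "outer (gelem u) (gelem v) = gelem (u, v)"
  by (simp add: outer_def lin_ext_linear)

lemma lookup_outer: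
  "Poly_Mapping.lookup (outer a b) (u, v) = Poly_Mapping.lookup a u * Poly_Mapping.lookup b v"
proof (induction a rule: free_vector_induct)
  case (basis x)
  show ?case
    by (induction b rule: free_vector_induct)
       (simp_all add: outer_gelem outer_right lookup_add lookup_gelem algebra_simps)
qed (simp_all add: outer_left lookup_add algebra_simps)

lemma tensor_coords_linear:
  "tensor_coords (p + q) = tensor_coords p + tensor_coords q"
  "tensor_coords (fscale c p) = fscale c (tensor_coords p)"
  "tensor_coords (gelem (a, b)) = outer a b"
  by (simp_all add: tensor_coords_def sweedler_linear)

lemma tensor_coords_diff: "tensor_coords (p - q) = tensor_coords p - tensor_coords q"
  by (rule additive.diff) (simp add: additive_def tensor_coords_linear)

definition tensor2_rels :: "(('x \<Rightarrow>\<^sub>0 'k::field) \<times> ('x \<Rightarrow>\<^sub>0 'k) \<Rightarrow>\<^sub>0 'k) set" where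
  "tensor2_rels = (\<Union>y. slot_rels fscale (\<lambda>x. (x, y)) \<union> slot_rels fscale (\<lambda>x. (y, x)))"

lemma tensor2_eq_iff_span: "tensor2_eq fscale p q \<longleftrightarrow> p - q \<in> free.span tensor2_rels"
  by (simp add: tensor2_eq_def tensor2_rels_def)

lemma slot_relsI:
  "gelem (t (x + y)) - gelem (t x) - gelem (t y) \<in> slot_rels s t"
  "gelem (t (s c x)) - fscale c (gelem (t x)) \<in> slot_rels s t"
  unfolding slot_rels_def gelem_def by blast+

lemma tensor_coords_rels:
  assumes "p \<in> tensor2_rels"
  shows "tensor_coords p = 0"
  using assms unfolding tensor2_rels_def slot_rels_def gelem_def [symmetric]
  by (auto simp: tensor_coords_diff tensor_coords_linear outer_left outer_right)

lemma tensor2_eq_add: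
  "tensor2_eq fscale p q \<Longrightarrow> tensor2_eq fscale p' q' \<Longrightarrow> tensor2_eq fscale (p + p') (q + q')"
  using free.span_add [of "p - q" tensor2_rels "p' - q'"]
  by (simp add: tensor2_eq_iff_span algebra_simps)

lemma tensor2_eq_fscale:
  "tensor2_eq fscale p q \<Longrightarrow> tensor2_eq fscale (fscale c p) (fscale c q)"
  using free.span_scale [of "p - q" tensor2_rels c]
  by (simp add: tensor2_eq_iff_span free.scale_right_diff_distrib)

lemma tensor2_eq_trans:
  "tensor2_eq fscale p q \<Longrightarrow> tensor2_eq fscale q r \<Longrightarrow> tensor2_eq fscale p r"
  using free.span_add [of "p - q" tensor2_rels "q - r"] by (simp add: tensor2_eq_iff_span)

lemma tensor2_eq_sym: "tensor2_eq fscale p q \<Longrightarrow> tensor2_eq fscale q p"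
  using free.span_neg [of "p - q" tensor2_rels] by (simp add: tensor2_eq_iff_span)

lemma tensor2_eq_bilinear:
  "tensor2_eq fscale (gelem (a + a', b)) (gelem (a, b) + gelem (a', b))"
  "tensor2_eq fscale (gelem (fscale c a, b)) (fscale c (gelem (a, b)))"
  "tensor2_eq fscale (gelem (a, b + b')) (gelem (a, b) + gelem (a, b'))"
  "tensor2_eq fscale (gelem (a, fscale c b)) (fscale c (gelem (a, b)))"
proof -
  have left: "r \<in> tensor2_rels" if "r \<in> slot_rels fscale (\<lambda>x. (x, b))" for r
    using that by (auto simp: tensor2_rels_def)
  have right: "r \<in> tensor2_rels" if "r \<in> slot_rels fscale (\<lambda>x. (a, x))" for r
    using that by (auto simp: tensor2_rels_def)
  show "tensor2_eq fscale (gelem (a + a', b)) (gelem (a, b) + gelem (a', b))"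
    unfolding tensor2_eq_iff_span diff_diff_eq [symmetric]
    by (rule free.span_base, rule left, rule slot_relsI(1) [where t = "\<lambda>x. (x, b)"])
  show "tensor2_eq fscale (gelem (fscale c a, b)) (fscale c (gelem (a, b)))"
    unfolding tensor2_eq_iff_span
    by (rule free.span_base, rule left, rule slot_relsI(2) [where t = "\<lambda>x. (x, b)"])
  show "tensor2_eq fscale (gelem (a, b + b')) (gelem (a, b) + gelem (a, b'))"
    unfolding tensor2_eq_iff_span diff_diff_eq [symmetric]
    by (rule free.span_base, rule right, rule slot_relsI(1) [where t = "\<lambda>x. (a, x)"])
  show "tensor2_eq fscale (gelem (a, fscale c b)) (fscale c (gelem (a, b)))"
    unfolding tensor2_eq_iff_span
    by (rule free.span_base, rule right, rule slot_relsI(2) [where t = "\<lambda>x. (a, x)"])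
qed

text \<open>Expanding both slots of every pure tensor by the multilinearity relations rewrites a formal
  sum into one that only involves tensors of basis vectors, and that one is determined by the
  coordinates. This is the spanning half of the fact that these tensors form a basis.\<close>

lemma tensor2_eq_canonical:
  fixes p :: "('x \<Rightarrow>\<^sub>0 'k::field) \<times> ('x \<Rightarrow>\<^sub>0 'k) \<Rightarrow>\<^sub>0 'k"
  defines "canonical \<equiv> lin_ext fscale (\<lambda>(u, v). gelem (gelem u, gelem v))"
  shows "tensor2_eq fscale p (canonical (tensor_coords p))"
proof (induction p rule: free_vector_induct)
  case (basis x)
  obtain a b where x: "x = (a, b)" by (cases x)
  have "tensor2_eq fscale (gelem (a, b)) (canonical (outer a b))"
  proof (induction a rule: free_vector_induct)
    case (basis u)
    show ?case
    proof (induction b rule: free_vector_induct)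
      case (basis v)
      show ?case
        by (simp add: canonical_def outer_gelem lin_ext_linear tensor2_eq_iff_span free.span_zero)
    next
      case (add b b')
      from tensor2_eq_trans [OF tensor2_eq_bilinear(3) tensor2_eq_add [OF add]]
      show ?case by (simp add: canonical_def outer_right lin_ext_linear)
    next
      case (scale c b)
      from tensor2_eq_trans [OF tensor2_eq_bilinear(4) tensor2_eq_fscale [OF scale]]
      show ?case by (simp add: canonical_def outer_right lin_ext_linear)
    qed
  next
    case (add a a')
    from tensor2_eq_trans [OF tensor2_eq_bilinear(1) tensor2_eq_add [OF add]]
    show ?case by (simp add: canonical_def outer_left lin_ext_linear)
  next
    case (scale c a)
    from tensor2_eq_trans [OF tensor2_eq_bilinear(2) tensor2_eq_fscale [OF scale]]
    show ?case by (simp add: canonical_def outer_left lin_ext_linear)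
  qed
  then show ?case by (simp add: x tensor_coords_linear)
next
  case (add p q)
  from tensor2_eq_add [OF add] show ?case
    by (simp add: canonical_def tensor_coords_linear lin_ext_linear)
next
  case (scale c p)
  from tensor2_eq_fscale [OF scale] show ?case
    by (simp add: canonical_def tensor_coords_linear lin_ext_linear)
qed

text \<open>The coordinates respect the congruence because \<open>outer\<close> is bilinear; conversely, equal
  coordinates give congruent formal sums because each is congruent to the same canonical one.\<close>

lemma tensor2_eq_iff_coords: "tensor2_eq fscale p q \<longleftrightarrow> tensor_coords p = tensor_coords q"
proof
  assume "tensor2_eq fscale p q"
  then have "p - q \<in> free.span tensor2_rels" by (simp add: tensor2_eq_iff_span)
  then have "tensor_coords (p - q) = 0"
  proof (induction rule: free.span_induct_alt)
    case base
    show ?case using tensor_coords_diff [of 0 0] by simp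
  next
    case (step c r r')
    then show ?case by (simp add: tensor_coords_linear tensor_coords_rels)
  qed
  then show "tensor_coords p = tensor_coords q" by (simp add: tensor_coords_diff)
next
  assume eq: "tensor_coords p = tensor_coords q"
  show "tensor2_eq fscale p q"
    by (rule tensor2_eq_trans [OF tensor2_eq_canonical [of p, unfolded eq]])
       (rule tensor2_eq_sym, rule tensor2_eq_canonical)
qed


section \<open>The bialgebra of a group\<close>

lemma group_coprod_linear:
  "group_coprod (a + b) = group_coprod a + group_coprod b"
  "group_coprod (fscale c a) = fscale c (group_coprod a)"
  "group_coprod (gelem g) = gelem (gelem g, gelem g)"
  unfolding group_coprod_def gelem_def [of "(_, _)", symmetric] by (simp_all add: lin_ext_linear)

lemma fscale_mult:
  fixes a b :: "'g::ab_group_add \<Rightarrow>\<^sub>0 'k::field"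
  shows "fscale c a * b = fscale c (a * b)" "a * fscale c b = fscale c (a * b)"
  unfolding fscale_def mult_map_scale_conv_mult by (simp_all add: mult_ac)

lemma bilinear_op_mult: "bilinear_op fscale ((*) :: ('g::ab_group_add \<Rightarrow>\<^sub>0 'k::field) \<Rightarrow> _)"
  by (simp add: bilinear_op_iff [OF vector_space_fscale] fscale_mult algebra_simps)

lemma gelem_zero: "gelem 0 = 1"
  by (simp add: gelem_def)

lemma lookup_tensor_coords_group_coprod:
  "Poly_Mapping.lookup (tensor_coords (group_coprod a)) (u, v)
     = (if u = v then Poly_Mapping.lookup a u else 0)"
  by (induction a rule: free_vector_induct)
     (auto simp: group_coprod_linear tensor_coords_linear lookup_outer lookup_add lookup_gelem)

text \<open>The representatives chosen by \<open>group_coprod\<close> depend linearly on the element, and for a group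
  element the representative is a single pure tensor. So the axioms hold already for
  representatives, as equations between formal sums, and only have to be checked on group
  elements.\<close>

lemma bialgebra_group_algebra:
  "bialgebra fscale ((*) :: ('g::ab_group_add \<Rightarrow>\<^sub>0 'k::field) \<Rightarrow> _) 1 group_coprod
     (lin_ext (*) (\<lambda>_. 1))"
proof -
  have field: "vector_space ((*) :: 'k \<Rightarrow> 'k \<Rightarrow> 'k)"
    by unfold_locales (simp_all add: algebra_simps)
  define counit :: "('g \<Rightarrow>\<^sub>0 'k) \<Rightarrow> 'k" where "counit = lin_ext (*) (\<lambda>_. 1)"
  note counit_linear = lin_ext_add [OF field, of "\<lambda>_ :: 'g. 1", folded counit_def]
    lin_ext_fscale [OF field, of "\<lambda>_ :: 'g. 1", folded counit_def]
    lin_ext_gelem [OF field, of "\<lambda>_ :: 'g. 1", folded counit_def]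
  note linear_simps = counit_linear group_coprod_linear sweedler_linear
    fscale_mult gelem_mult distrib_left distrib_right free.scale_right_distrib
  have tensor_refl: "tensor2_eq fscale p q" if "p = q" for p q :: "('g \<Rightarrow>\<^sub>0 'k) \<times> _ \<Rightarrow>\<^sub>0 'k"
    using that by (simp add: tensor2_eq_iff_coords)
  have counit_right: "sweedler fscale (\<lambda>a1 a2. fscale (counit a2) a1) (group_coprod a) = a" for a
    by (induction a rule: free_vector_induct) (simp_all add: linear_simps)
  have counit_left: "sweedler fscale (\<lambda>a1 a2. fscale (counit a1) a2) (group_coprod a) = a" for a
    by (induction a rule: free_vector_induct) (simp_all add: linear_simps)
  have coassoc: "sweedler fscale (\<lambda>a1 a2. sweedler fscale
         (\<lambda>x y. gelem (x, y, a2)) (group_coprod a1)) (group_coprod a)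
     = sweedler fscale (\<lambda>a1 a2. sweedler fscale
         (\<lambda>x y. gelem (a1, x, y)) (group_coprod a2)) (group_coprod a)" for a :: "'g \<Rightarrow>\<^sub>0 'k"
    by (induction a rule: free_vector_induct) (simp_all add: linear_simps)
  have coprod_mult: "group_coprod (a * b) = sweedler fscale (\<lambda>a1 a2. sweedler fscale
         (\<lambda>b1 b2. gelem (a1 * b1, a2 * b2)) (group_coprod b)) (group_coprod a)"
    for a b :: "'g \<Rightarrow>\<^sub>0 'k"
  proof (induction a rule: free_vector_induct)
    case (basis g)
    show ?case by (induction b rule: free_vector_induct) (simp_all add: linear_simps)
  qed (simp_all add: linear_simps)
  have counit_mult: "counit (a * b) = counit a * counit b" for a b
  proof (induction a rule: free_vector_induct)
    case (basis g)
    show ?case by (induction b rule: free_vector_induct) (simp_all add: linear_simps)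
  qed (simp_all add: linear_simps)
  have coprod_one: "group_coprod (1 :: 'g \<Rightarrow>\<^sub>0 'k) = gelem (1, 1)"
    using group_coprod_linear(3) [of "0 :: 'g"] by (simp add: gelem_zero)
  have counit_one: "counit 1 = 1"
    using counit_linear(3) [of 0] by (simp add: gelem_zero)
  note pure = gelem_def [of "(_, _)", symmetric]
  show ?thesis unfolding counit_def [symmetric]
  proof (intro bialgebra.intro bialgebra_axioms.intro vector_space_fscale)
    fix a b c :: "'g \<Rightarrow>\<^sub>0 'k" and r :: 'k
    show "bilinear_op fscale ((*) :: ('g \<Rightarrow>\<^sub>0 'k) \<Rightarrow> _)" by (rule bilinear_op_mult)
    show "Vector_Spaces.linear fscale (*) counit"
      by (simp add: Vector_Spaces.linear_iff vector_space_fscale field counit_linear)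
    show "a * b * c = a * (b * c)" by (rule mult.assoc)
    show "tensor3_eq fscale
        (sweedler fscale (\<lambda>a1 a2. sweedler fscale
           (\<lambda>x y. Poly_Mapping.single (x, y, a2) 1) (group_coprod a1)) (group_coprod a))
        (sweedler fscale (\<lambda>a1 a2. sweedler fscale
           (\<lambda>x y. Poly_Mapping.single (a1, x, y) 1) (group_coprod a2)) (group_coprod a))"
      unfolding pure coassoc by (simp add: tensor3_eq_def free.span_zero)
    show "tensor2_eq fscale (group_coprod (a * b)) (sweedler fscale (\<lambda>a1 a2. sweedler fscale
        (\<lambda>b1 b2. Poly_Mapping.single (a1 * b1, a2 * b2) 1) (group_coprod b)) (group_coprod a))"
      unfolding pure by (rule tensor_refl) (rule coprod_mult)
    show "tensor2_eq fscale (group_coprod 1) (Poly_Mapping.single (1, 1 :: 'g \<Rightarrow>\<^sub>0 'k) 1)"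
      unfolding pure by (rule tensor_refl) (rule coprod_one)
    show "1 * a = a" "a * 1 = a" by simp_all
    show "tensor2_eq fscale (group_coprod (a + b)) (group_coprod a + group_coprod b)"
      by (rule tensor_refl) (rule group_coprod_linear)
    show "tensor2_eq fscale (group_coprod (fscale r a)) (fscale r (group_coprod a))"
      by (rule tensor_refl) (rule group_coprod_linear)
    show "sweedler fscale (\<lambda>a1 a2. fscale (counit a1) a2) (group_coprod a) = a"
      by (rule counit_left)
    show "sweedler fscale (\<lambda>a1 a2. fscale (counit a2) a1) (group_coprod a) = a"
      by (rule counit_right)
    show "counit (a * b) = counit a * counit b" by (rule counit_mult)
    show "counit 1 = 1" by (rule counit_one)
  qed
qed


section \<open>Compatibility with the coproduct\<close>

text \<open>At \<open>(u, v)\<close> the coordinates of the two sides are \<open>x\<^sub>u\<close> if \<open>u = v\<close>, and the sum of \<open>x\<^sub>v\<close> if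
  \<open>u = g\<close> and \<open>x\<^sub>u\<close> if \<open>v = h\<close>. The diagonal shows that \<open>x\<close> is supported on \<open>{g, h}\<close>, and that
  \<open>x = 0\<close> if \<open>g = h\<close>, where it reads \<open>x\<^sub>g = x\<^sub>g + x\<^sub>g\<close>. For \<open>g \<noteq> h\<close> the coordinate at \<open>(g, h)\<close> gives
  \<open>0 = x\<^sub>h + x\<^sub>g\<close>.\<close>

lemma skew_primitive_iff:
  "tensor_coords (group_coprod x) = outer (gelem g) x + outer x (gelem h)
    \<longleftrightarrow> x = fscale (Poly_Mapping.lookup x g) (gelem g - gelem h)" (is "?L \<longleftrightarrow> ?R")
proof
  assume ?L
  have eq: "(if u = v then Poly_Mapping.lookup x u else 0)
      = (if g = u then Poly_Mapping.lookup x v else 0)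
        + (if h = v then Poly_Mapping.lookup x u else 0)" for u v
    using arg_cong [where f = "\<lambda>t. Poly_Mapping.lookup t (u, v)", OF \<open>?L\<close>]
    by (simp add: lookup_tensor_coords_group_coprod lookup_add lookup_outer lookup_gelem)
  show ?R
  proof (rule poly_mapping_eqI)
    fix k
    show "Poly_Mapping.lookup x k
      = Poly_Mapping.lookup (fscale (Poly_Mapping.lookup x g) (gelem g - gelem h)) k"
      using eq [of k k] eq [of g h]
      by (auto simp: lookup_minus lookup_gelem add_eq_0_iff split: if_splits)
  qed
next
  assume ?R
  define c where "c = Poly_Mapping.lookup x g"
  have x: "x = fscale c (gelem g - gelem h)" using \<open>?R\<close> by (simp add: c_def)
  show ?L unfolding x
    by (rule poly_mapping_eqI)
       (auto simp: lookup_tensor_coords_group_coprod lookup_outer lookup_minus lookup_add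
         lookup_gelem)
qed

text \<open>In coordinates both sides of the compatibility are bilinear in \<open>a\<close> and \<open>b\<close>. On group
  elements, which are grouplike, the compatibility says that their product is skew-primitive.\<close>

lemma coprod_prelie_iff:
  fixes prelie :: "('g::ab_group_add \<Rightarrow>\<^sub>0 'k::field) \<Rightarrow> ('g \<Rightarrow>\<^sub>0 'k) \<Rightarrow> ('g \<Rightarrow>\<^sub>0 'k)"
  assumes "bilinear_op fscale prelie"
  shows "(\<forall>a b. tensor2_eq fscale (group_coprod (prelie a b))
      (sweedler fscale (\<lambda>a1 a2. Poly_Mapping.single (a1, prelie a2 b) 1) (group_coprod a) +
       sweedler fscale (\<lambda>a1 a2. sweedler fscale
         (\<lambda>b1 b2. Poly_Mapping.single (prelie a1 b1, a2 * b2) 1) (group_coprod b)) (group_coprod a)))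
    \<longleftrightarrow> (\<forall>g h. prelie (gelem g) (gelem h) =
          fscale (Poly_Mapping.lookup (prelie (gelem g) (gelem h)) g) (gelem g - gelem (g + h)))"
    (is "(\<forall>a b. ?compat a b) \<longleftrightarrow> (\<forall>g h. ?skew g h)")
proof -
  define L where "L a b = tensor_coords (group_coprod (prelie a b))" for a b
  define R where "R a b = sweedler fscale (\<lambda>a1 a2. outer a1 (prelie a2 b)) (group_coprod a) +
       sweedler fscale (\<lambda>a1 a2. sweedler fscale
         (\<lambda>b1 b2. outer (prelie a1 b1) (a2 * b2)) (group_coprod b)) (group_coprod a)" for a b
  note linear_simps = bilinear_op_fscaleD [OF assms] group_coprod_linear tensor_coords_linear
    sweedler_linear outer_left outer_right
  have compat: "?compat a b \<longleftrightarrow> L a b = R a b" for a b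
    unfolding tensor2_eq_iff_coords gelem_def [of "(_, _)", symmetric] L_def R_def
    by (simp add: tensor_coords_linear sweedler_comp_linear [where T = tensor_coords])
  have L_linear: "L (a + a') b = L a b + L a' b" "L (fscale c a) b = fscale c (L a b)"
    "L a (b + b') = L a b + L a b'" "L a (fscale c b) = fscale c (L a b)" for a a' b b' c
    by (simp_all add: L_def linear_simps)
  have R_left: "R (a + a') b = R a b + R a' b" "R (fscale c a) b = fscale c (R a b)"
    for a a' b c
    by (simp_all add: R_def linear_simps free.scale_right_distrib)
  have R_gelem: "R (gelem g) b = outer (gelem g) (prelie (gelem g) b)
      + sweedler fscale (\<lambda>b1 b2. outer (prelie (gelem g) b1) (gelem g * b2)) (group_coprod b)"
    for g b
    by (simp add: R_def linear_simps)
  have basis: "L (gelem g) (gelem h) = R (gelem g) (gelem h) \<longleftrightarrow> ?skew g h" for g h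
    by (simp add: R_gelem linear_simps L_def gelem_mult flip: skew_primitive_iff)
  have extend: "L a b = R a b" if "\<And>g h. L (gelem g) (gelem h) = R (gelem g) (gelem h)" for a b
  proof (induction a rule: free_vector_induct)
    case (basis g)
    show ?case
      by (induction b rule: free_vector_induct)
         (simp_all add: that, simp_all add: L_linear R_gelem linear_simps free.scale_right_distrib)
  qed (simp_all add: L_linear R_left)
  show ?thesis
  proof (intro iffI allI)
    fix g h
    assume all: "\<forall>a b. ?compat a b"
    show "?skew g h"
      by (rule iffD1 [OF basis], rule iffD1 [OF compat], rule spec [OF spec [OF all]])
  next
    fix a b
    assume all: "\<forall>g h. ?skew g h"
    show "?compat a b"
      by (rule iffD2 [OF compat], rule extend, rule iffD2 [OF basis], rule spec [OF spec [OF all]])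
  qed
qed


section \<open>The pre-Lie identity\<close>

definition associator :: "('a \<Rightarrow> 'a \<Rightarrow> 'a::ab_group_add) \<Rightarrow> 'a \<Rightarrow> 'a \<Rightarrow> 'a \<Rightarrow> 'a" where
  "associator m a b c = m (m a b) c - m a (m b c)"

text \<open>Additivity splits \<open>lam (g + h) k\<close>, which the inner product \<open>(g \<bullet> h) \<bullet> k\<close> produces. Its part
  \<open>lam g k\<close> completes a term that is symmetric in \<open>h\<close> and \<open>k\<close>; its part \<open>lam h k\<close> combines with
  \<open>g \<bullet> (h \<bullet> k)\<close> so that the group element \<open>g + h\<close> cancels.\<close>

lemma associator_gelem:
  fixes prelie :: "('g::ab_group_add \<Rightarrow>\<^sub>0 'k::field) \<Rightarrow> ('g \<Rightarrow>\<^sub>0 'k) \<Rightarrow> ('g \<Rightarrow>\<^sub>0 'k)"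
  assumes "bilinear_op fscale prelie"
    and additive: "\<And>g h k. lam (g + h) k = lam g k + lam h k"
    and form: "\<And>g h. prelie (gelem g) (gelem h) = fscale (lam g h) (gelem g - gelem (g + h))"
  shows "associator prelie (gelem g) (gelem h) (gelem k)
    = fscale (lam g h * lam g k) (gelem g - gelem (g + h) - gelem (g + k) + gelem (g + h + k))
      + fscale (lam g (h + k) * lam h k - lam g h * lam h k) (gelem g - gelem (g + (h + k)))"
proof -
  note linear = bilinear_op_fscaleD [OF assms(1)]
  have diff: "prelie (a - a') b = prelie a b - prelie a' b"
      "prelie a (b - b') = prelie a b - prelie a b'" for a a' b b'
    using additive.diff [of "\<lambda>a. prelie a b"] additive.diff [of "prelie a"]
    by (simp_all add: linear additive_def)
  show ?thesis
    by (rule poly_mapping_eqI)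
       (simp add: associator_def form diff linear additive lookup_minus lookup_add add.assoc
         algebra_simps)
qed

text \<open>After the symmetric term is cancelled, two multiples of the same vector \<open>g - (g + (h + k))\<close>
  are compared, and this vector is zero exactly if \<open>h + k = 0\<close>.\<close>

lemma associator_symmetric_iff:
  fixes prelie :: "('g::ab_group_add \<Rightarrow>\<^sub>0 'k::field) \<Rightarrow> ('g \<Rightarrow>\<^sub>0 'k) \<Rightarrow> ('g \<Rightarrow>\<^sub>0 'k)"
  assumes "bilinear_op fscale prelie"
    and "\<And>g h k. lam (g + h) k = lam g k + lam h k"
    and "\<And>g h. prelie (gelem g) (gelem h) = fscale (lam g h) (gelem g - gelem (g + h))"
  shows "associator prelie (gelem g) (gelem h) (gelem k)
      = associator prelie (gelem g) (gelem k) (gelem h)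
    \<longleftrightarrow> (h + k \<noteq> 0 \<longrightarrow>
          lam g (h + k) * lam h k - lam g h * lam h k
            = lam g (h + k) * lam k h - lam g k * lam k h)"
proof -
  define d :: "'g \<Rightarrow>\<^sub>0 'k" where "d = gelem g - gelem (g + (h + k))"
  let ?c = "\<lambda>h k. lam g (h + k) * lam h k - lam g h * lam h k"
  have "associator prelie (gelem g) (gelem h) (gelem k)
      = associator prelie (gelem g) (gelem k) (gelem h)
    \<longleftrightarrow> fscale (?c h k) d = fscale (?c k h) d"
    unfolding associator_gelem [OF assms] d_def by (simp add: ac_simps diff_right_commute)
  also have "\<dots> \<longleftrightarrow> ?c h k = ?c k h \<or> d = 0"
    by simp
  also have "d = 0 \<longleftrightarrow> h + k = 0"
  proof
    assume "d = 0"
    then have "Poly_Mapping.lookup d g = 0" by simp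
    then show "h + k = 0" by (simp add: d_def lookup_minus lookup_gelem split: if_splits)
  qed (simp add: d_def)
  finally show ?thesis by (auto simp: add.commute)
qed

lemma associator_symmetric_from_basis:
  assumes "bilinear_op fscale m"
    and basis: "\<And>g h k. associator m (gelem g) (gelem h) (gelem k)
      = associator m (gelem g) (gelem k) (gelem h)"
  shows "associator m a b c = associator m a c b"
proof -
  have assoc_linear:
    "associator m (a + a') b c = associator m a b c + associator m a' b c"
    "associator m a (b + b') c = associator m a b c + associator m a b' c"
    "associator m a b (c + c') = associator m a b c + associator m a b c'"
    "associator m (fscale r a) b c = fscale r (associator m a b c)"
    "associator m a (fscale r b) c = fscale r (associator m a b c)"
    "associator m a b (fscale r c) = fscale r (associator m a b c)" for a a' b b' c c' r
    by (simp_all add: associator_def bilinear_op_fscaleD [OF assms(1)]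
        free.scale_right_diff_distrib)
  show ?thesis
  proof (induction a rule: free_vector_induct)
    case (basis g)
    show ?case
    proof (induction b rule: free_vector_induct)
      case (basis h)
      show ?case
        by (induction c rule: free_vector_induct) (simp_all add: assms(2) assoc_linear)
    qed (simp_all add: assoc_linear)
  qed (simp_all add: assoc_linear)
qed


section \<open>The Leibniz rule\<close>

lemma leibniz_from_basis:
  fixes prelie :: "('g::ab_group_add \<Rightarrow>\<^sub>0 'k::field) \<Rightarrow> ('g \<Rightarrow>\<^sub>0 'k) \<Rightarrow> ('g \<Rightarrow>\<^sub>0 'k)"
  assumes "bilinear_op fscale prelie"
    and basis: "\<And>g h k. prelie (gelem g * gelem h) (gelem k)
      = prelie (gelem g) (gelem k) * gelem h + gelem g * prelie (gelem h) (gelem k)"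
  shows "prelie (a * b) c = prelie a c * b + a * prelie b c"
proof -
  note linear_simps = bilinear_op_fscaleD [OF assms(1)] fscale_mult distrib_left distrib_right
    free.scale_right_distrib
  show ?thesis
  proof (induction a rule: free_vector_induct)
    case (basis g)
    show ?case
    proof (induction b rule: free_vector_induct)
      case (basis h)
      show ?case
        by (induction c rule: free_vector_induct) (simp_all add: assms(2) linear_simps)
    qed (simp_all add: linear_simps)
  qed (simp_all add: linear_simps)
qed

text \<open>Both sides of the Leibniz rule are multiples of \<open>(g + h) - (g + h + k)\<close>. This vector vanishes
  only for \<open>k = 0\<close>, and there the normalization \<open>lam g 0 = 0\<close> makes \<open>lam\<close> additive as well.\<close>

lemma leibniz_basis_iff:
  fixes prelie :: "('g::ab_group_add \<Rightarrow>\<^sub>0 'k::field) \<Rightarrow> ('g \<Rightarrow>\<^sub>0 'k) \<Rightarrow> ('g \<Rightarrow>\<^sub>0 'k)"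
  assumes zero: "\<And>g. lam g 0 = 0"
    and form: "\<And>g h. prelie (gelem g) (gelem h) = fscale (lam g h) (gelem g - gelem (g + h))"
  shows "prelie (gelem g * gelem h) (gelem k)
      = prelie (gelem g) (gelem k) * gelem h + gelem g * prelie (gelem h) (gelem k)
    \<longleftrightarrow> lam (g + h) k = lam g k + lam h k"
proof -
  define d :: "'g \<Rightarrow>\<^sub>0 'k" where "d = gelem (g + h) - gelem (g + h + k)"
  have "prelie (gelem g) (gelem k) * gelem h + gelem g * prelie (gelem h) (gelem k)
      = fscale (lam g k + lam h k) d"
    by (simp add: form fscale_mult left_diff_distrib right_diff_distrib gelem_mult d_def
        free.scale_left_distrib ac_simps)
  moreover have "prelie (gelem g * gelem h) (gelem k) = fscale (lam (g + h) k) d"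
    by (simp add: gelem_mult form d_def)
  moreover have "k = 0" if "d = 0"
  proof -
    from that have "Poly_Mapping.lookup d (g + h) = 0" by simp
    then show ?thesis by (simp add: d_def lookup_minus lookup_gelem split: if_splits)
  qed
  ultimately show ?thesis by (auto simp: zero)
qed


section \<open>The classification\<close>

theorem theorem5p2:
  fixes prelie :: "('g::ab_group_add \<Rightarrow>\<^sub>0 'k::field_char_0) \<Rightarrow> ('g \<Rightarrow>\<^sub>0 'k) \<Rightarrow> ('g \<Rightarrow>\<^sub>0 'k)"
  assumes "bilinear_op fscale prelie"
  shows "com_prelie_bialgebra fscale (*) prelie group_coprod \<longleftrightarrow>
    (\<exists>lam :: 'g \<Rightarrow> 'g \<Rightarrow> 'k.
       (\<forall>g. lam g 0 = 0) \<and>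
       (\<forall>g h k. lam (g + h) k = lam g k + lam h k) \<and>
       (\<forall>g h k. h + k \<noteq> 0 \<longrightarrow>
          lam g (h + k) * lam h k - lam g h * lam h k
            = lam g (h + k) * lam k h - lam g k * lam k h) \<and>
       (\<forall>g h. prelie (gelem g) (gelem h) = fscale (lam g h) (gelem g - gelem (g + h))))"
    (is "?bialg \<longleftrightarrow> (\<exists>lam. ?zero lam \<and> ?additive lam \<and> ?quadratic lam \<and> ?form lam)")
proof
  assume ?bialg
  then interpret com_prelie_bialgebra fscale "(*)" prelie group_coprod .
  define lam where "lam g h = Poly_Mapping.lookup (prelie (gelem g) (gelem h)) g" for g h
  have form: "prelie (gelem g) (gelem h) = fscale (lam g h) (gelem g - gelem (g + h))" for g h
    unfolding lam_def
    by (rule spec [OF spec [OF iffD1 [OF coprod_prelie_iff [OF assms]]]])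
       (intro allI coprod_prelie)
  have zero: "lam g 0 = 0" for g
  proof -
    have "prelie (gelem g) (gelem 0) = 0" by (simp add: form)
    then show ?thesis by (simp add: lam_def)
  qed
  have additive: "lam (g + h) k = lam g k + lam h k" for g h k
    by (rule iffD1 [OF leibniz_basis_iff [OF zero form]]) (rule prelie_leibniz)
  have quadratic: "h + k \<noteq> 0 \<longrightarrow> lam g (h + k) * lam h k - lam g h * lam h k
      = lam g (h + k) * lam k h - lam g k * lam k h" for g h k
    by (rule iffD1 [OF associator_symmetric_iff [OF assms additive form]])
       (unfold associator_def, rule prelie_identity)
  show "\<exists>lam. ?zero lam \<and> ?additive lam \<and> ?quadratic lam \<and> ?form lam"
    by (intro exI [of _ lam] conjI allI zero additive quadratic form)
next
  assume "\<exists>lam. ?zero lam \<and> ?additive lam \<and> ?quadratic lam \<and> ?form lam"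
  then obtain lam where lam: "?zero lam" "?additive lam" "?quadratic lam" "?form lam"
    by (elim exE conjE)
  note zero = lam(1) [THEN spec]
    and additive = lam(2) [THEN spec, THEN spec, THEN spec]
    and quadratic = lam(3) [THEN spec, THEN spec, THEN spec]
    and form = lam(4) [THEN spec, THEN spec]
  \<comment> \<open>For \<open>h = 0\<close> the coefficient of \<open>g\<close> is zero whatever the scalar is, so here the normalization
      of \<open>lam\<close> enters.\<close>
  have coef: "Poly_Mapping.lookup (prelie (gelem g) (gelem h)) g = lam g h" for g h
    by (auto simp: form zero lookup_minus lookup_gelem)
  show ?bialg
  proof unfold_locales
    fix a b c :: "'g \<Rightarrow>\<^sub>0 'k"
    show "bilinear_op fscale ((*) :: ('g \<Rightarrow>\<^sub>0 'k) \<Rightarrow> _)" by (rule bilinear_op_mult)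
    show "bilinear_op fscale prelie" by fact
    show "a * b * c = a * (b * c)" "a * b = b * a" by (simp_all add: ac_simps)
    have "associator prelie a b c = associator prelie a c b"
      by (rule associator_symmetric_from_basis [OF assms],
          rule iffD2 [OF associator_symmetric_iff [OF assms additive form]], rule quadratic)
    then show "prelie (prelie a b) c - prelie a (prelie b c)
        = prelie (prelie a c) b - prelie a (prelie c b)"
      by (simp add: associator_def)
    show "prelie (a * b) c = prelie a c * b + a * prelie b c"
      by (rule leibniz_from_basis [OF assms],
          rule iffD2 [OF leibniz_basis_iff [OF zero form]], rule additive)
    show "\<exists>unit counit. bialgebra fscale ((*) :: ('g \<Rightarrow>\<^sub>0 'k) \<Rightarrow> _) unit group_coprod counit"
      by (intro exI) (rule bialgebra_group_algebra)
    show "tensor2_eq fscale (group_coprod (prelie a b))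
      (sweedler fscale (\<lambda>a1 a2. Poly_Mapping.single (a1, prelie a2 b) 1) (group_coprod a) +
       sweedler fscale (\<lambda>a1 a2. sweedler fscale
         (\<lambda>b1 b2. Poly_Mapping.single (prelie a1 b1, a2 * b2) 1) (group_coprod b)) (group_coprod a))"
      by (rule spec [OF spec [OF iffD2 [OF coprod_prelie_iff [OF assms]]]])
         (unfold coef, intro allI form)
  qed
qed

end
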